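(* Let $k\ge 2$ and $t\ge 1$ be integers. A Toeplitz graph $T_n\langle t,2t,\ldots,kt\rangle$ is a line graph if and only if one of the following is true: (i) $k=2$ and $2t+1\le n\le 5t$; (ii) $k\ge 3$ and $kt+1\le n\le (k+1)t$.
   Context: For integers $1\le t_1<\cdots<t_k<n$, the Toeplitz graph $T_n\langle t_1,\ldots,t_k\rangle$ is the simple graph with vertex set $\{1,\ldots,n\}$ in which $v$ and $w$ are adjacent if and only if $|v-w|\in\{t_1,\ldots,t_k\}$. The line graph $L(H)$ of a graph $H$ has the edge set of $H$ as its vertex set, two vertices being adjacent if and only if the corresponding edges of $H$ have a vertex in common. A graph $G$ is a line graph if it is isomorphic to $L(H)$ for some graph $H$. *)

theory Defs
  imports Main
begin

type_synonym 'a ugraph = "'a set \<times> 'a set set"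

abbreviation verts :: "'a ugraph \<Rightarrow> 'a set" where
  "verts G \<equiv> fst G"

abbreviation edges :: "'a ugraph \<Rightarrow> 'a set set" where
  "edges G \<equiv> snd G"

definition simple_graph :: "'a ugraph \<Rightarrow> bool" where
  "simple_graph G \<longleftrightarrow> finite (verts G) \<and> (\<forall>e\<in>edges G. e \<subseteq> verts G \<and> card e = 2)"

definition graph_iso :: "'a ugraph \<Rightarrow> 'b ugraph \<Rightarrow> bool" where
  "graph_iso G H \<longleftrightarrow> (\<exists>f. bij_betw f (verts G) (verts H) \<and>
     (\<forall>u\<in>verts G. \<forall>v\<in>verts G. {u, v} \<in> edges G \<longleftrightarrow> {f u, f v} \<in> edges H))"

definition line_graph :: "'a ugraph \<Rightarrow> 'a set ugraph" where
  "line_graph H = (edges H, {{e, f} | e f. e \<in> edges H \<and> f \<in> edges H \<and> e \<noteq> f \<and> e \<inter> f \<noteq> {}})"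

text \<open>The root graph \<open>H\<close> ranges over all finite simple graphs. HOL cannot quantify over its
  vertex type, so its vertices are taken to be natural numbers; \<open>is_line_graphI\<close> below shows
  that root graphs over any other type yield nothing more.\<close>

definition is_line_graph :: "'a ugraph \<Rightarrow> bool" where
  "is_line_graph G \<longleftrightarrow> (\<exists>H :: nat ugraph. simple_graph H \<and> graph_iso G (line_graph H))"

text \<open>The differences are given as the set \<open>D = {t\<^sub>1, \<dots>, t\<^sub>k}\<close>, intended for \<open>D \<subseteq> {1..<n}\<close>.\<close>

definition toeplitz_graph :: "nat \<Rightarrow> nat set \<Rightarrow> nat ugraph" where
  "toeplitz_graph n D =
     ({1..n}, {{v, w} | v w. v \<in> {1..n} \<and> w \<in> {1..n} \<and> \<bar>int v - int w\<bar> \<in> int ` D})"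

lemma simple_graph_toeplitz_graph:
  assumes "D \<subseteq> {1..<n}"
  shows "simple_graph (toeplitz_graph n D)"
  using assms by (fastforce simp: simple_graph_def toeplitz_graph_def card_2_iff)

lemma simple_graph_line_graph:
  assumes "simple_graph H"
  shows "simple_graph (line_graph H)"
proof -
  have "edges H \<subseteq> Pow (verts H)" "finite (verts H)"
    using assms by (auto simp: simple_graph_def)
  then have "finite (edges H)"
    by (meson finite_Pow_iff finite_subset)
  then show ?thesis
    by (auto simp: simple_graph_def line_graph_def card_2_iff)
qed

lemma is_line_graphI:
  fixes G :: "'a ugraph" and H :: "'b ugraph"
  assumes H: "simple_graph H" and iso: "graph_iso G (line_graph H)"
  shows "is_line_graph G"
proof -
  obtain g :: "'b \<Rightarrow> nat" where g: "inj_on g (verts H)"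
    using H finite_imp_inj_to_nat_seg unfolding simple_graph_def by meson
  define H' where "H' = (g ` verts H, (`) g ` edges H)"
  have sub: "e \<subseteq> verts H" if "e \<in> edges H" for e
    using H that by (auto simp: simple_graph_def)
  have "simple_graph H'"
    using H g by (auto simp: simple_graph_def H'_def card_image inj_on_subset)
  moreover
  have inj: "inj_on ((`) g) (edges H)"
    using g sub by (meson PowI inj_on_image_Pow inj_on_subset subsetI)
  obtain f where f: "bij_betw f (verts G) (edges H)"
    and adj: "\<And>u v. u \<in> verts G \<Longrightarrow> v \<in> verts G \<Longrightarrow>
      {u, v} \<in> edges G \<longleftrightarrow> {f u, f v} \<in> edges (line_graph H)"
    using iso by (auto simp: graph_iso_def line_graph_def)
  have L: "{a, b} \<in> edges (line_graph K) \<longleftrightarrow> a \<in> edges K \<and> b \<in> edges K \<and> a \<noteq> b \<and> a \<inter> b \<noteq> {}"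
    for K :: "nat ugraph" and a b
    by (auto simp: line_graph_def doubleton_eq_iff)
  have M: "{a, b} \<in> edges (line_graph K) \<longleftrightarrow> a \<in> edges K \<and> b \<in> edges K \<and> a \<noteq> b \<and> a \<inter> b \<noteq> {}"
    for K :: "'b ugraph" and a b
    by (auto simp: line_graph_def doubleton_eq_iff)
  have "bij_betw ((`) g \<circ> f) (verts G) (verts (line_graph H'))"
    using bij_betw_trans[OF f bij_betw_imageI[OF inj refl]]
    by (simp add: line_graph_def H'_def)
  moreover have "{u, v} \<in> edges G \<longleftrightarrow> {g ` f u, g ` f v} \<in> edges (line_graph H')"
    if uv: "u \<in> verts G" "v \<in> verts G" for u v
  proof -
    have fu: "f u \<in> edges H" "f v \<in> edges H"
      using f uv by (auto simp: bij_betw_def)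
    have "g ` f u \<inter> g ` f v = g ` (f u \<inter> f v)"
      using inj_on_image_Int[OF g] sub fu by metis
    moreover have "g ` f u = g ` f v \<longleftrightarrow> f u = f v"
      using inj fu by (auto simp: inj_on_def)
    ultimately show ?thesis
      unfolding adj[OF uv] L M using fu by (auto simp: H'_def)
  qed
  ultimately show ?thesis
    unfolding is_line_graph_def graph_iso_def by (metis comp_apply)
qed

end

theory Submission
  imports Defs
begin

text \<open>
  Call distinct integers linked if they have the same residue modulo \<open>t\<close> and their quotients differ
  by at most \<open>k\<close>. After the shift \<open>v \<mapsto> v - 1\<close> this is adjacency in
  \<open>T\<^sub>n\<langle>t, 2t, \<dots>, kt\<rangle>\<close>, so the Toeplitz graph is a disjoint union of \<open>k\<close>-th powers of paths, one
  for each residue, and the largest of them has \<open>\<lceil>n/t\<rceil>\<close> vertices. Being a line graph passes to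
  induced subgraphs and to disjoint unions. The question is therefore for which \<open>m\<close> the \<open>k\<close>-th
  power of the path on \<open>m\<close> vertices is a line graph
  (\<open>path_power_labelling_if_toeplitz\<close>, \<open>is_line_graph_toeplitzI\<close>).

  For \<open>m \<le> k + 1\<close> the power is complete, which is the line graph of a star. For \<open>k = 2\<close> and
  \<open>m \<le> 5\<close> it is an induced subgraph of the line graph of the bull, a triangle with pendant edges
  at two of its vertices. Beyond these bounds there are two obstructions. If \<open>k \<ge> 3\<close> and
  \<open>m \<ge> k + 2\<close>, the path power contains \<open>K\<^sub>5\<close> minus an edge
  (\<open>no_three_edges_joining_disjoint\<close>). If \<open>k = 2\<close> and \<open>m \<ge> 6\<close>, it contains two triangles
  \<open>123\<close> and \<open>234\<close> which both have to come from stars of the root graph, because each has a vertex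
  outside it adjacent to exactly one of its corners (\<open>odd_triangle_is_star\<close>); as the stars share two
  edges, they have the same centre, and so \<open>1\<close> and \<open>4\<close> would be adjacent.
\<close>

section \<open>Line graphs as intersection graphs of pairs\<close>

text \<open>
  An isomorphism onto the line graph of a simple graph, recorded only by the edge of the root graph
  that each vertex is sent to. The root graph is recovered as the image, so none of its
  components has to be mentioned in the arguments below.
\<close>

definition edge_labelling :: "'a set \<Rightarrow> ('a \<Rightarrow> 'a \<Rightarrow> bool) \<Rightarrow> ('a \<Rightarrow> 'b set) \<Rightarrow> bool" where
  "edge_labelling V R f \<longleftrightarrow> inj_on f V \<and> (\<forall>v\<in>V. card (f v) = 2) \<and>
     (\<forall>u\<in>V. \<forall>v\<in>V. u \<noteq> v \<longrightarrow> (R u v \<longleftrightarrow> f u \<inter> f v \<noteq> {}))"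

lemma edge_line_graph_iff:
  "{a, b} \<in> edges (line_graph H) \<longleftrightarrow> a \<in> edges H \<and> b \<in> edges H \<and> a \<noteq> b \<and> a \<inter> b \<noteq> {}"
  by (auto simp: line_graph_def doubleton_eq_iff)

lemma edge_labelling_if_is_line_graph:
  assumes "is_line_graph G"
  obtains f :: "'a \<Rightarrow> nat set" where "edge_labelling (verts G) (\<lambda>u v. {u, v} \<in> edges G) f"
proof -
  obtain H :: "nat ugraph" and f
    where H: "simple_graph H" and f: "bij_betw f (verts G) (edges H)"
      and adj: "\<forall>u\<in>verts G. \<forall>v\<in>verts G. {u, v} \<in> edges G \<longleftrightarrow> {f u, f v} \<in> edges (line_graph H)"
    using assms by (auto simp: is_line_graph_def graph_iso_def line_graph_def)
  have mem: "f v \<in> edges H" if "v \<in> verts G" for v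
    using f that by (auto simp: bij_betw_def)
  have inj: "inj_on f (verts G)"
    using f by (simp add: bij_betw_def)
  have "card (f v) = 2" if "v \<in> verts G" for v
    using mem[OF that] H by (auto simp: simple_graph_def)
  moreover have "{u, v} \<in> edges G \<longleftrightarrow> f u \<inter> f v \<noteq> {}"
    if "u \<in> verts G" "v \<in> verts G" "u \<noteq> v" for u v
    using adj that mem inj by (simp add: edge_line_graph_iff inj_on_eq_iff)
  ultimately show thesis
    using inj by (intro that[of f]) (simp add: edge_labelling_def)
qed

lemma is_line_graph_if_edge_labelling:
  assumes G: "simple_graph G" and f: "edge_labelling (verts G) (\<lambda>u v. {u, v} \<in> edges G) f"
  shows "is_line_graph G"
proof (rule is_line_graphI)
  let ?H = "(\<Union> (f ` verts G), f ` verts G)"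
  have "finite (f v)" if "v \<in> verts G" for v
    using f that by (intro card_ge_0_finite) (simp add: edge_labelling_def)
  then show "simple_graph ?H"
    using f G by (auto simp: simple_graph_def edge_labelling_def)
  have "{v} \<notin> edges G" for v
    using G by (force simp: simple_graph_def)
  then have "{u, v} \<in> edges G \<longleftrightarrow> {f u, f v} \<in> edges (line_graph ?H)"
    if "u \<in> verts G" "v \<in> verts G" for u v
    using f that unfolding edge_line_graph_iff edge_labelling_def
    by (cases "u = v") (auto simp: inj_on_eq_iff)
  moreover have "bij_betw f (verts G) (verts (line_graph ?H))"
    using f by (simp add: edge_labelling_def line_graph_def bij_betw_def)
  ultimately show "graph_iso G (line_graph ?H)"
    unfolding graph_iso_def by blast
qed

section \<open>Reduction to powers of paths\<close>

definition path_power_labelling :: "nat \<Rightarrow> nat \<Rightarrow> (nat \<Rightarrow> 'b set) \<Rightarrow> bool" where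
  "path_power_labelling k m = edge_labelling {..<m} (\<lambda>i j. \<bar>int i - int j\<bar> \<le> int k)"

lemma multiple_abs_diff_iff:
  fixes a b t k :: nat
  assumes "t \<ge> 1" and "a \<noteq> b"
  shows "\<bar>int a - int b\<bar> \<in> int ` (\<lambda>j. j * t) ` {1..k} \<longleftrightarrow>
    a mod t = b mod t \<and> \<bar>int (a div t) - int (b div t)\<bar> \<le> int k"
  using assms(2)
proof (induction a b rule: linorder_wlog)
  case (le a b)
  have abs: "\<bar>int a - int b\<bar> = int (b - a)"
    using le by simp
  show ?case
  proof
    assume "\<bar>int a - int b\<bar> \<in> int ` (\<lambda>j. j * t) ` {1..k}"
    then obtain j where "j \<le> k" "int (b - a) = int (j * t)"
      unfolding abs by (auto simp del: of_nat_mult)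
    then have "b = a + j * t"
      using le by linarith
    then show "a mod t = b mod t \<and> \<bar>int (a div t) - int (b div t)\<bar> \<le> int k"
      using \<open>j \<le> k\<close> assms(1) by simp
  next
    assume R: "a mod t = b mod t \<and> \<bar>int (a div t) - int (b div t)\<bar> \<le> int k"
    define j where "j = b div t - a div t"
    have "b div t * t = a div t * t + (b - a)"
      using R le div_mult_mod_eq[of a t] div_mult_mod_eq[of b t] by linarith
    then have eq: "b - a = j * t"
      by (simp add: j_def diff_mult_distrib)
    moreover have "j \<le> k" "j \<noteq> 0"
      using R le eq by (auto simp: j_def)
    ultimately show "\<bar>int a - int b\<bar> \<in> int ` (\<lambda>j. j * t) ` {1..k}"
      unfolding abs eq by (intro imageI) auto
  qed
next
  case (sym a b)
  then show ?case
    by (metis abs_minus_commute)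
qed

lemma edge_toeplitz_iff:
  assumes "u \<in> {1..n}" "v \<in> {1..n}"
  shows "{u, v} \<in> edges (toeplitz_graph n D) \<longleftrightarrow> \<bar>int u - int v\<bar> \<in> int ` D"
  using assms by (auto simp: toeplitz_graph_def doubleton_eq_iff abs_minus_commute)

text \<open>
  Vertex \<open>v\<close> is vertex number \<open>(v - 1) div t\<close> of the path belonging to the residue
  \<open>(v - 1) mod t\<close>. The shift by one makes the path of residue 0 the longest one.
\<close>

lemma edge_toeplitz_multiples_iff:
  assumes "t \<ge> 1" "u \<in> {1..n}" "v \<in> {1..n}" "u \<noteq> v"
  shows "{u, v} \<in> edges (toeplitz_graph n ((\<lambda>j. j * t) ` {1..k})) \<longleftrightarrow>
    (u - 1) mod t = (v - 1) mod t \<and> \<bar>int ((u - 1) div t) - int ((v - 1) div t)\<bar> \<le> int k"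
proof -
  have "int u - int v = int (u - 1) - int (v - 1)"
    using assms by auto
  moreover have "u - 1 \<noteq> v - 1"
    using assms by auto
  ultimately show ?thesis
    using edge_toeplitz_iff[OF assms(2,3)] multiple_abs_diff_iff[OF assms(1)] by metis
qed

lemma path_power_labelling_if_toeplitz:
  assumes "t \<ge> 1" "m * t < n"
    and "is_line_graph (toeplitz_graph n ((\<lambda>j. j * t) ` {1..k}))"
  obtains g :: "nat \<Rightarrow> nat set" where "path_power_labelling k (m + 1) g"
proof -
  obtain f :: "nat \<Rightarrow> nat set" where
    f: "edge_labelling {1..n} (\<lambda>u v. {u, v} \<in> edges (toeplitz_graph n ((\<lambda>j. j * t) ` {1..k}))) f"
    using edge_labelling_if_is_line_graph[OF assms(3)] by (auto simp: toeplitz_graph_def)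
  have mem: "i * t + 1 \<in> {1..n}" if "i < m + 1" for i
  proof -
    have "i * t \<le> m * t"
      using that by simp
    then have "i * t < n"
      using assms(2) by (rule le_less_trans)
    then show ?thesis
      by simp
  qed
  have neq: "i * t + 1 \<noteq> j * t + 1" if "i \<noteq> j" for i j
    using that assms(1) by simp
  have "path_power_labelling k (m + 1) (\<lambda>i. f (i * t + 1))"
    unfolding path_power_labelling_def edge_labelling_def
  proof (intro conjI ballI impI)
    show "inj_on (\<lambda>i. f (i * t + 1)) {..<m + 1}"
    proof (rule inj_onI)
      fix i j assume ij: "i \<in> {..<m + 1}" "j \<in> {..<m + 1}" "f (i * t + 1) = f (j * t + 1)"
      then have "i * t + 1 = j * t + 1"
        using f mem unfolding edge_labelling_def by (meson inj_onD lessThan_iff)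
      then show "i = j"
        using neq by blast
    qed
    show "card (f (i * t + 1)) = 2" if "i \<in> {..<m + 1}" for i
      using f mem that unfolding edge_labelling_def by blast
    fix i j assume ij: "i \<in> {..<m + 1}" "j \<in> {..<m + 1}" "i \<noteq> j"
    then have ij': "i * t + 1 \<in> {1..n}" "j * t + 1 \<in> {1..n}" "i * t + 1 \<noteq> j * t + 1"
      using mem neq by blast+
    have "f (i * t + 1) \<inter> f (j * t + 1) \<noteq> {} \<longleftrightarrow>
        {i * t + 1, j * t + 1} \<in> edges (toeplitz_graph n ((\<lambda>j. j * t) ` {1..k}))"
      using f ij' unfolding edge_labelling_def by blast
    also have "\<dots> \<longleftrightarrow> \<bar>int i - int j\<bar> \<le> int k"
      using edge_toeplitz_multiples_iff[OF assms(1) ij', of k] assms(1) by simp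
    finally show "\<bar>int i - int j\<bar> \<le> int k \<longleftrightarrow> f (i * t + 1) \<inter> f (j * t + 1) \<noteq> {}"
      by simp
  qed
  then show thesis
    by (rule that)
qed

text \<open>The root graph is a disjoint union of copies of one root graph, tagged by the residue.\<close>

lemma is_line_graph_toeplitzI:
  assumes "t \<ge> 1" "k * t < n" "n \<le> m * t" and g: "path_power_labelling k m g"
  shows "is_line_graph (toeplitz_graph n ((\<lambda>j. j * t) ` {1..k}))"
proof (rule is_line_graph_if_edge_labelling)
  have "j * t < n" if "j \<le> k" for j
    using that assms(2) by (meson le_less_trans mult_le_mono1)
  then show "simple_graph (toeplitz_graph n ((\<lambda>j. j * t) ` {1..k}))"
    using assms(1) by (intro simple_graph_toeplitz_graph) auto
  define f where "f v = Pair ((v - 1) mod t) ` g ((v - 1) div t)" for v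
  have inj: "inj_on g {..<m}" and card: "\<And>i. i < m \<Longrightarrow> card (g i) = 2"
    and adj: "\<And>i j. i < m \<Longrightarrow> j < m \<Longrightarrow> i \<noteq> j \<Longrightarrow> \<bar>int i - int j\<bar> \<le> int k \<longleftrightarrow> g i \<inter> g j \<noteq> {}"
    using g by (simp_all add: path_power_labelling_def edge_labelling_def)
  have q: "(v - 1) div t < m" if "v \<in> {1..n}" for v
    using that assms(1,3) by (auto simp: less_mult_imp_div_less)
  have card_f: "card (f v) = 2" if "v \<in> {1..n}" for v
    unfolding f_def using card[OF q[OF that]] by (simp add: card_image inj_on_def)
  have quotient_neq: "(u - 1) div t \<noteq> (v - 1) div t"
    if "u \<in> {1..n}" "v \<in> {1..n}" "u \<noteq> v" "(u - 1) mod t = (v - 1) mod t" for u v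
  proof
    assume "(u - 1) div t = (v - 1) div t"
    then have "u - 1 = v - 1"
      using that(4) by (metis div_mult_mod_eq)
    then show False
      using that(1-3) by auto
  qed
  have adj_f: "{u, v} \<in> edges (toeplitz_graph n ((\<lambda>j. j * t) ` {1..k})) \<longleftrightarrow> f u \<inter> f v \<noteq> {}"
    if uv: "u \<in> {1..n}" "v \<in> {1..n}" "u \<noteq> v" for u v
  proof -
    have "f u \<inter> f v \<noteq> {} \<longleftrightarrow>
        (u - 1) mod t = (v - 1) mod t \<and> g ((u - 1) div t) \<inter> g ((v - 1) div t) \<noteq> {}"
      by (auto simp: f_def)
    then show ?thesis
      using edge_toeplitz_multiples_iff[OF assms(1) uv] adj[OF q[OF uv(1)] q[OF uv(2)]]
        quotient_neq[OF uv] by blast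
  qed
  have "inj_on f {1..n}"
  proof (rule inj_onI, rule ccontr)
    fix u v assume uv: "u \<in> {1..n}" "v \<in> {1..n}" "f u = f v" "u \<noteq> v"
    have "f u \<noteq> {}"
      using card_f[OF uv(1)] by auto
    then have r: "(u - 1) mod t = (v - 1) mod t"
      using uv(3) unfolding f_def by blast
    then have "g ((u - 1) div t) = g ((v - 1) div t)"
      using uv(3) unfolding f_def by (simp add: inj_image_eq_iff inj_def)
    then show False
      using inj q uv quotient_neq[OF uv(1,2,4) r] by (meson inj_onD lessThan_iff)
  qed
  then show "edge_labelling (verts (toeplitz_graph n ((\<lambda>j. j * t) ` {1..k})))
      (\<lambda>u v. {u, v} \<in> edges (toeplitz_graph n ((\<lambda>j. j * t) ` {1..k}))) f"
    using card_f adj_f by (simp add: edge_labelling_def toeplitz_graph_def)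
qed

section \<open>Path powers that are line graphs\<close>

text \<open>A complete graph is the line graph of a star, here with centre 0.\<close>

lemma path_power_labelling_star: "path_power_labelling k (k + 1) (\<lambda>i. {0, Suc i})"
  by (auto simp: path_power_labelling_def edge_labelling_def inj_on_def doubleton_eq_iff)

text \<open>The root is the bull: triangle \<open>0, 1, 2\<close> with pendant edges \<open>03\<close> and \<open>14\<close>.\<close>

lemma path_power_labelling_bull:
  "path_power_labelling 2 5 ((!) [{0::nat, 3}, {0, 2}, {0, 1}, {1, 2}, {1, 4}])"
proof -
  have "{..<5} = {0, 1, 2, 3, 4 :: nat}"
    by auto
  then show ?thesis
    by (simp add: path_power_labelling_def edge_labelling_def inj_on_def doubleton_eq_iff)
qed

section \<open>Path powers that are not line graphs\<close>

lemma pair_eqI: "card e = 2 \<Longrightarrow> x \<in> e \<Longrightarrow> y \<in> e \<Longrightarrow> x \<noteq> y \<Longrightarrow> e = {x, y}"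
  by (auto simp: card_2_iff)

text \<open>
  Three pairwise intersecting edges form a star or a triangle, and in a triangle every vertex
  lies on two of the three edges, so no further edge \<open>d\<close> meets exactly one of them.
\<close>

lemma odd_triangle_is_star:
  assumes "card a = 2" "card b = 2" "card c = 2" "a \<noteq> b"
    and "a \<inter> b \<noteq> {}" "a \<inter> c \<noteq> {}" "b \<inter> c \<noteq> {}"
    and d: "d \<inter> c \<noteq> {}" "d \<inter> a = {}" "d \<inter> b = {}"
  shows "a \<inter> b \<inter> c \<noteq> {}"
proof
  assume no_centre: "a \<inter> b \<inter> c = {}"
  obtain x y z where xyz: "x \<in> a" "x \<in> b" "y \<in> a" "y \<in> c" "z \<in> b" "z \<in> c"
    using assms by blast
  then have "x \<noteq> y" "x \<noteq> z" "y \<noteq> z"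
    using no_centre by auto
  then have "a = {x, y}" "b = {x, z}" "c = {y, z}"
    using xyz assms(1-3) by (simp_all add: pair_eqI)
  then show False
    using d by auto
qed

lemma not_path_power_labelling_square:
  assumes "m \<ge> 6"
  shows "\<not> path_power_labelling 2 m g"
proof
  assume "path_power_labelling 2 m g"
  then have card: "\<And>i. i < 6 \<Longrightarrow> card (g i) = 2"
    and inj: "\<And>i j. i < 6 \<Longrightarrow> j < 6 \<Longrightarrow> i \<noteq> j \<Longrightarrow> g i \<noteq> g j"
    and adj: "\<And>i j. i < 6 \<Longrightarrow> j < 6 \<Longrightarrow> i \<noteq> j \<Longrightarrow>
      g i \<inter> g j \<noteq> {} \<longleftrightarrow> \<bar>int i - int j\<bar> \<le> 2"
    using assms by (auto simp: path_power_labelling_def edge_labelling_def inj_on_def)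
  \<comment> \<open>Vertex 5 makes the triangle \<open>123\<close> odd, vertex 0 the triangle \<open>234\<close>.\<close>
  have "g 1 \<inter> g 2 \<inter> g 3 \<noteq> {}"
    using adj[of 1 2] adj[of 1 3] adj[of 2 3] adj[of 5 3] adj[of 5 1] adj[of 5 2] inj[of 1 2]
    by (intro odd_triangle_is_star[where d = "g 5"]) (simp_all add: card)
  moreover have "g 3 \<inter> g 4 \<inter> g 2 \<noteq> {}"
    using adj[of 3 4] adj[of 3 2] adj[of 4 2] adj[of 0 2] adj[of 0 3] adj[of 0 4] inj[of 3 4]
    by (intro odd_triangle_is_star[where d = "g 0"]) (simp_all add: card)
  ultimately obtain x y where x: "x \<in> g 1" "x \<in> g 2" "x \<in> g 3" and y: "y \<in> g 3" "y \<in> g 4" "y \<in> g 2"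
    by blast
  \<comment> \<open>The two stars share the edges \<open>g 2\<close> and \<open>g 3\<close>, which have only one vertex in common.\<close>
  have "x = y"
    using x y pair_eqI[of "g 2" x y] pair_eqI[of "g 3" x y] card[of 2] card[of 3] inj[of 2 3]
    by auto
  then show False
    using x y adj[of 1 4] by auto
qed

text \<open>
  The edges meeting two disjoint edges \<open>a\<close> and \<open>b\<close> form a 4-cycle, and any three edges of a
  4-cycle include two opposite ones. Hence \<open>K\<^sub>5\<close> minus an edge is not a line graph.
\<close>

lemma no_three_edges_joining_disjoint:
  assumes "card a = 2" "card b = 2" "a \<inter> b = {}"
    and joins: "\<And>x. x \<in> {c, d, e} \<Longrightarrow> card x = 2 \<and> x \<inter> a \<noteq> {} \<and> x \<inter> b \<noteq> {}"
    and "c \<noteq> d" "c \<noteq> e" "d \<noteq> e"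
    and meet: "c \<inter> d \<noteq> {}" "c \<inter> e \<noteq> {}" "d \<inter> e \<noteq> {}"
  shows False
proof -
  obtain p q r s where ab: "a = {p, q}" "b = {r, s}" and "p \<noteq> q" "r \<noteq> s"
    using assms(1,2) by (auto simp: card_2_iff)
  then have neq: "p \<noteq> q" "r \<noteq> s" "p \<noteq> r" "p \<noteq> s" "q \<noteq> r" "q \<noteq> s"
    using assms(3) by auto
  have cycle: "h \<in> {{p, r}, {p, s}, {q, r}, {q, s}}" if h: "h \<in> {c, d, e}" for h
  proof -
    obtain x y where xy: "x \<in> h" "x \<in> a" "y \<in> h" "y \<in> b"
      using joins[OF h] by blast
    then have "h = {x, y}"
      using joins[OF h] assms(3) by (intro pair_eqI) auto
    then show ?thesis
      using xy ab by auto
  qed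
  have "c \<in> {{p, r}, {p, s}, {q, r}, {q, s}}" "d \<in> {{p, r}, {p, s}, {q, r}, {q, s}}"
    "e \<in> {{p, r}, {p, s}, {q, r}, {q, s}}"
    using cycle by blast+
  then show False
    using meet neq \<open>c \<noteq> d\<close> \<open>c \<noteq> e\<close> \<open>d \<noteq> e\<close> by (elim insertE emptyE; simp)
qed

text \<open>Here 0 and \<open>k + 1\<close> are the two nonadjacent vertices of \<open>K\<^sub>5\<close> minus an edge.\<close>

lemma not_path_power_labelling_ge_3:
  assumes "k \<ge> 3" "m \<ge> k + 2"
  shows "\<not> path_power_labelling k m g"
proof
  assume "path_power_labelling k m g"
  then have card: "\<And>i. i \<le> k + 1 \<Longrightarrow> card (g i) = 2"
    and inj: "\<And>i j. i \<le> k + 1 \<Longrightarrow> j \<le> k + 1 \<Longrightarrow> i \<noteq> j \<Longrightarrow> g i \<noteq> g j"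
    and adj: "\<And>i j. i \<le> k + 1 \<Longrightarrow> j \<le> k + 1 \<Longrightarrow> i \<noteq> j \<Longrightarrow>
      g i \<inter> g j \<noteq> {} \<longleftrightarrow> \<bar>int i - int j\<bar> \<le> int k"
    using assms by (auto simp: path_power_labelling_def edge_labelling_def inj_on_def)
  have joins: "card e = 2 \<and> e \<inter> g 0 \<noteq> {} \<and> e \<inter> g (k + 1) \<noteq> {}" if e: "e \<in> {g 1, g 2, g 3}" for e
  proof -
    obtain i where "e = g i" "1 \<le> i" "i \<le> 3"
      using e by fastforce
    then show ?thesis
      using card[of i] adj[of i 0] adj[of i "k + 1"] assms(1) by auto
  qed
  show False
  proof (rule no_three_edges_joining_disjoint[OF _ _ _ joins])
    show "g 0 \<inter> g (k + 1) = {}"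
      using adj[of 0 "k + 1"] by auto
    show "g 1 \<inter> g 2 \<noteq> {}" "g 1 \<inter> g 3 \<noteq> {}" "g 2 \<inter> g 3 \<noteq> {}"
      using adj[of 1 2] adj[of 1 3] adj[of 2 3] assms(1) by simp_all
  qed (use assms(1) card inj in auto)
qed

section \<open>The characterization\<close>

theorem theorem5p1:
  fixes k t n :: nat
  assumes "k \<ge> 2" and "t \<ge> 1" and "k * t < n"
  shows "is_line_graph (toeplitz_graph n ((\<lambda>j. j * t) ` {1..k})) \<longleftrightarrow>
    (k = 2 \<and> 2 * t + 1 \<le> n \<and> n \<le> 5 * t) \<or>
    (k \<ge> 3 \<and> k * t + 1 \<le> n \<and> n \<le> (k + 1) * t)"
proof (cases "k = 2")
  case True
  have "n \<le> 5 * t" if G: "is_line_graph (toeplitz_graph n ((\<lambda>j. j * t) ` {1..k}))"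
  proof (rule ccontr)
    assume "\<not> n \<le> 5 * t"
    then obtain g :: "nat \<Rightarrow> nat set" where "path_power_labelling k (5 + 1) g"
      using path_power_labelling_if_toeplitz[OF assms(2) _ G] by (metis not_le)
    then show False
      using not_path_power_labelling_square[of "5 + 1" g] True by simp
  qed
  moreover have "is_line_graph (toeplitz_graph n ((\<lambda>j. j * t) ` {1..k}))" if "n \<le> 5 * t"
    using is_line_graph_toeplitzI[OF assms(2,3) that] path_power_labelling_bull True by blast
  ultimately show ?thesis
    using True assms(3) by auto
next
  case False
  then have k: "k \<ge> 3"
    using assms(1) by simp
  have "n \<le> (k + 1) * t" if G: "is_line_graph (toeplitz_graph n ((\<lambda>j. j * t) ` {1..k}))"
  proof (rule ccontr)
    assume "\<not> n \<le> (k + 1) * t"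
    then obtain g :: "nat \<Rightarrow> nat set" where "path_power_labelling k (k + 1 + 1) g"
      using path_power_labelling_if_toeplitz[OF assms(2) _ G] by (metis not_le)
    then show False
      using not_path_power_labelling_ge_3[of k "k + 1 + 1" g] k by simp
  qed
  moreover have "is_line_graph (toeplitz_graph n ((\<lambda>j. j * t) ` {1..k}))" if "n \<le> (k + 1) * t"
    using is_line_graph_toeplitzI[OF assms(2,3) that path_power_labelling_star] .
  ultimately show ?thesis
    using k assms(3) by auto
qed

end
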